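(* Let $p$ be an odd prime, $n\ge1$, let $r>t\ge 0$ be integers and let $c\in\mathbb{F}_p^*$. Then: (i) $f(x)=\mathrm{Tr}_n\big(cx^{p^r+1}-cx^{p^t+1}\big)$ is near-bent if and only if $\gcd(n,r+t)=\gcd(n,r-t)=\gcd(n,p)=1$; (ii) $f(x)=\mathrm{Tr}_n\big(cx^{p^r+1}+cx^{p^t+1}\big)$ is near-bent if and only if $\gcd(n,2(r+t))=\gcd(n,2(r-t))=2$, $r-t$ is odd, and $\gcd(n,p)=1$.
   Context: $\epsilon_p=e^{2\pi i/p}$, $\mathrm{Tr}_n$ is the absolute trace $\mathbb{F}_{p^n}\to\mathbb{F}_p$, $\widehat{f}(b)=\sum_{x\in\mathbb{F}_{p^n}}\epsilon_p^{f(x)-\mathrm{Tr}_n(bx)}$. A function $f:\mathbb{F}_{p^n}\to\mathbb{F}_p$ is near-bent if $|\widehat{f}(b)|^2\in\{0,p^{n+1}\}$ for all $b\in\mathbb{F}_{p^n}$. *)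

theory Defs
  imports Complex_Main "HOL-Computational_Algebra.Primes"
begin

text \<open>The finite field F_{p^n} is modelled as a finite field type 'a with CARD('a) = p^n.
  The prime field F_p is the image of of_nat in 'a.\<close>

definition prime_field :: "'a::field set" where
  "prime_field = range of_nat"

definition trace :: "nat \<Rightarrow> nat \<Rightarrow> 'a::field \<Rightarrow> 'a" where
  "trace p n x = (\<Sum>i<n. x ^ (p ^ i))"

definition fp_val :: "nat \<Rightarrow> 'a::field \<Rightarrow> nat" where
  "fp_val p y = (THE k. k < p \<and> of_nat k = y)"

definition eps :: "nat \<Rightarrow> 'a::field \<Rightarrow> complex" where
  "eps p y = cis (2 * pi * real (fp_val p y) / real p)"

definition walsh :: "nat \<Rightarrow> nat \<Rightarrow> ('a::{field,finite} \<Rightarrow> 'a) \<Rightarrow> 'a \<Rightarrow> complex" where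
  "walsh p n f b = (\<Sum>x\<in>UNIV. eps p (f x - trace p n (b * x)))"

definition near_bent :: "nat \<Rightarrow> nat \<Rightarrow> ('a::{field,finite} \<Rightarrow> 'a) \<Rightarrow> bool" where
  "near_bent p n f \<longleftrightarrow>
     (\<forall>b. (cmod (walsh p n f b))\<^sup>2 \<in> {0, real p ^ (n + 1)})"

end

theory Submission
  imports Defs "HOL-Number_Theory.Residues" "HOL-Computational_Algebra.Polynomial"
begin

text \<open>
  Write \<open>\<sigma>\<close> for the Frobenius map, \<open>a = r + t\<close>, \<open>b = r - t\<close>. Polarising the quadratic form
  \<open>Tr (c x\<^bsup>p\<^sup>r + 1\<^esup> \<mp> c x\<^bsup>p\<^sup>t + 1\<^esup>)\<close> and using that the trace is invariant under \<open>\<sigma>\<close> gives the bilinear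
  form \<open>Tr (c \<sigma>\<^sup>r(x) M(y))\<close> with \<open>M = (\<sigma>\<^sup>a \<mp> 1) (\<sigma>\<^sup>b \<mp> 1)\<close>. Hence the squared Walsh coefficients
  are \<open>0\<close> or \<open>p\<^sup>n |ker M|\<close>, not all of them \<open>0\<close>, and near-bentness means \<open>|ker M| = p\<close>.

  For the minus sign the kernel contains the fixed fields of \<open>\<sigma>\<^sup>a\<close> and \<open>\<sigma>\<^sup>b\<close>, which forces the two
  gcd conditions, and, if \<open>p\<close> divides \<open>n\<close>, also a solution of \<open>\<sigma> w = w + 1\<close>. Conversely, for \<open>y\<close> in the
  kernel \<open>\<sigma>\<^sup>b y - y\<close> lies in the prime field and has trace \<open>0\<close>, so it vanishes when \<open>p\<close> does not
  divide \<open>n\<close>. The plus sign reduces to the minus sign by scaling with an element \<open>u\<close> such that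
  \<open>\<sigma> u = -u\<close>.
\<close>

section \<open>Finite groups and characters\<close>

text \<open>The fibres over the range are translates of the kernel, so they all have its size. Later
  applied to relative traces and to the map \<open>frob 1 x - x\<close>.\<close>

lemma card_kernel_times_card_range:
  fixes h :: "'a::{ab_group_add,finite} \<Rightarrow> 'b::ab_group_add"
  assumes add: "\<And>x y. h (x + y) = h x + h y"
  shows "card {x. h x = 0} * card (range h) = card (UNIV :: 'a set)"
proof -
  have diff: "h (x - y) = h x - h y" for x y
    using add[of "x - y" y] by simp
  have "card (h -` {z}) = card {x. h x = 0}" if "z \<in> range h" for z
  proof -
    from that obtain x0 where x0: "z = h x0" by auto
    have "bij_betw (\<lambda>x. x + x0) {x. h x = 0} (h -` {z})"
      by (rule bij_betw_byWitness[where f' = "\<lambda>x. x - x0"]) (auto simp: add diff x0)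
    then show ?thesis by (simp add: bij_betw_same_card)
  qed
  moreover have "card (UNIV :: 'a set) = (\<Sum>z\<in>range h. card (h -` {z}))"
  proof -
    have "(UNIV :: 'a set) = (\<Union>z\<in>range h. h -` {z})" by auto
    then show ?thesis
      using card_UN_disjoint[of "range h" "\<lambda>z. h -` {z}"] by fastforce
  qed
  ultimately show ?thesis by simp
qed

text \<open>Translation by \<open>y\<close> permutes \<open>K\<close> and multiplies the sum by
  \<open>h y\<close>. Multiplicativity is asked on \<open>K\<close> only, because the Walsh summand
  is a character merely on the kernel of \<open>M\<close>.\<close>

lemma sum_character_on_subgroup:
  fixes h :: "'a::ab_group_add \<Rightarrow> 'b::field"
  assumes "finite K" and add: "\<And>x y. x \<in> K \<Longrightarrow> y \<in> K \<Longrightarrow> x + y \<in> K"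
    and diff: "\<And>x y. x \<in> K \<Longrightarrow> y \<in> K \<Longrightarrow> x - y \<in> K"
    and mult: "\<And>x y. x \<in> K \<Longrightarrow> y \<in> K \<Longrightarrow> h (x + y) = h x * h y"
    and y: "y \<in> K" and nontriv: "h y \<noteq> 1"
  shows "sum h K = 0"
proof -
  have "sum h K = (\<Sum>x\<in>K. h (x + y))"
    by (rule sum.reindex_bij_witness[of _ "\<lambda>x. x + y" "\<lambda>x. x - y"]) (use add diff y in auto)
  also have "\<dots> = sum h K * h y"
    using mult y by (simp add: sum_distrib_right)
  finally have "sum h K * (h y - 1) = 0" by (simp add: algebra_simps)
  then show ?thesis using nontriv by simp
qed

text \<open>Multiplication by a nonzero \<open>x\<close> permutes the nonzero elements; comparing
  their products gives the claim, and zero is checked separately.\<close>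

lemma power_card_eq_self:
  fixes x :: "'a::{field,finite}"
  shows "x ^ card (UNIV :: 'a set) = x"
proof (cases "x = 0")
  case True
  then show ?thesis using finite_UNIV_card_ge_0[where ?'a = 'a] by auto
next
  case False
  let ?U = "UNIV - {0 :: 'a}"
  have "\<Prod>?U = (\<Prod>y\<in>?U. x * y)"
    by (rule prod.reindex_bij_witness[of _ "(*) x" "\<lambda>y. y / x"]) (use False in auto)
  also have "\<dots> = x ^ card ?U * \<Prod>?U" by (simp add: prod.distrib)
  finally have "x ^ card ?U = 1" by simp
  moreover have "card (UNIV :: 'a set) = Suc (card ?U)"
    by (rule card_Suc_Diff1[symmetric]) simp_all
  ultimately show ?thesis by (simp only: power_Suc mult_1_right)
qed

section \<open>The Frobenius map and the trace\<close>

locale finite_field_ext =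
  fixes p n :: nat and ty :: "'a::{field,finite} itself"
  assumes p: "prime p" and n: "n \<ge> 1" and card_UNIV: "card (UNIV :: 'a set) = p ^ n"
begin

definition frob :: "nat \<Rightarrow> 'a \<Rightarrow> 'a" where
  "frob k x = x ^ (p ^ k)"

lemma p_gt_1: "p > 1"
  using p by (rule prime_gt_1_nat)

lemma CHAR_eq: "CHAR('a) = p"
proof -
  have "prime CHAR('a)"
    by (rule prime_CHAR_semidom) (rule finite_imp_CHAR_pos, simp)
  moreover have "CHAR('a) dvd p ^ n"
    using CHAR_dvd_CARD[where ?'a = 'a] unfolding card_UNIV .
  ultimately show ?thesis
    using primes_dvd_imp_eq[OF _ p] prime_dvd_power[of "CHAR('a)" p n] by iprover
qed

lemma of_nat_eq_0: "of_nat k = (0 :: 'a) \<longleftrightarrow> p dvd k"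
  unfolding of_nat_eq_0_iff_char_dvd CHAR_eq ..

lemma of_nat_eq: "of_nat j = (of_nat k :: 'a) \<longleftrightarrow> j mod p = k mod p"
  unfolding of_nat_eq_iff_cong_CHAR CHAR_eq cong_def ..

lemma frob_add: "frob k (x + y) = frob k x + frob k y"
  unfolding frob_def using freshmans_dream'[of "p ^ k" k x y] p by (simp add: CHAR_eq)

lemma frob_0_left [simp]: "frob 0 x = x"
  by (simp add: frob_def)

lemma frob_0 [simp]: "frob k 0 = 0"
  using p_gt_1 by (simp add: frob_def)

lemma frob_1 [simp]: "frob k 1 = 1"
  by (simp add: frob_def)

lemma frob_diff: "frob k (x - y) = frob k x - frob k y"
  using frob_add[of k "x - y" y] by simp

lemma frob_uminus: "frob k (- x) = - frob k x"
  using frob_diff[of k 0 x] by simp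

lemma frob_mult: "frob k (x * y) = frob k x * frob k y"
  by (simp add: frob_def power_mult_distrib)

lemma frob_inverse: "frob k (inverse x) = inverse (frob k x)"
  by (simp add: frob_def power_inverse)

lemma frob_frob: "frob j (frob k x) = frob (j + k) x"
  by (simp add: frob_def power_add mult.commute flip: power_mult)

lemma frob_sum: "frob k (sum g A) = (\<Sum>i\<in>A. frob k (g i))"
  by (induction A rule: infinite_finite_induct) (auto simp: frob_add)

lemma frob_of_nat [simp]: "frob k (of_nat j) = of_nat j"
  by (induction j) (auto simp: frob_add)

lemma frob_n: "frob n x = x"
  unfolding frob_def card_UNIV[symmetric] by (rule power_card_eq_self)

lemma frob_eq_0_iff [simp]: "frob k x = 0 \<longleftrightarrow> x = 0"
  using p_gt_1 by (simp add: frob_def)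

lemma inj_frob: "inj (frob k)"
proof (rule injI)
  fix x y assume "frob k x = frob k y"
  then have "frob k (x - y) = 0" by (simp add: frob_diff)
  then show "x = y" by simp
qed

lemma frob_fixed_mult: "frob k x = x \<Longrightarrow> frob (k * j) x = x"
proof (induction j)
  case (Suc j)
  have "frob (k * Suc j) x = frob k (frob (k * j) x)" by (simp add: frob_frob)
  then show ?case using Suc by simp
qed simp

text \<open>Bezout in the exponents: \<open>frob n\<close> is the identity, so fixed points of
  \<open>frob k\<close> are fixed by every power whose exponent is combined from \<open>n\<close>
  and \<open>k\<close>.\<close>

lemma frob_fixed_gcd:
  assumes "frob k x = x"
  shows "frob (gcd n k) x = x"
proof -
  obtain i j where ij: "n * i = k * j + gcd n k"
    using bezout_nat[of n k] n by auto
  have "x = frob (n * i) x" by (simp add: frob_fixed_mult frob_n)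
  also have "\<dots> = frob (gcd n k) (frob (k * j) x)" by (simp add: ij frob_frob add.commute)
  also have "\<dots> = frob (gcd n k) x" by (simp add: frob_fixed_mult assms)
  finally show ?thesis by simp
qed

section \<open>Counting fixed points of Frobenius powers\<close>

lemma card_frob_fixed_le:
  assumes "k \<ge> 1"
  shows "card {x. frob k x = x} \<le> p ^ k"
proof -
  have pk: "p ^ k > 1" using p_gt_1 assms by (intro one_less_power) auto
  let ?q = "Polynomial.monom (1 :: 'a) (p ^ k) - Polynomial.monom 1 1"
  have "coeff ?q (p ^ k) = 1" using pk by simp
  then have "?q \<noteq> 0" by (metis coeff_0 zero_neq_one)
  then have "card {x. poly ?q x = 0} \<le> degree ?q" by (rule card_poly_roots_bound)
  also have "degree ?q \<le> p ^ k"
    using pk by (intro degree_diff_le) (auto simp: degree_monom_eq)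
  finally show ?thesis by (simp add: poly_monom frob_def)
qed

lemma card_prime_field: "card (prime_field :: 'a set) = p"
proof -
  have "range (of_nat :: nat \<Rightarrow> 'a) = of_nat ` {..<p}"
  proof safe
    fix k :: nat
    have "of_nat k = (of_nat (k mod p) :: 'a)" by (simp add: of_nat_eq)
    then show "of_nat k \<in> (of_nat :: nat \<Rightarrow> 'a) ` {..<p}" using p_gt_1 by auto
  qed auto
  moreover have "inj_on (of_nat :: nat \<Rightarrow> 'a) {..<p}"
    by (auto simp: inj_on_def of_nat_eq)
  ultimately show ?thesis by (simp add: prime_field_def card_image)
qed

text \<open>The prime field already supplies \<open>p\<close> fixed points, and a polynomial of
  degree \<open>p\<close> has no further roots.\<close>

lemma prime_field_eq_fixed: "prime_field = {x. frob 1 x = x}"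
proof (rule card_seteq)
  show "prime_field \<subseteq> {x. frob 1 x = x}" by (auto simp: prime_field_def)
  show "card {x. frob 1 x = x} \<le> card (prime_field :: 'a set)"
    using card_frob_fixed_le[of 1] by (simp add: card_prime_field)
qed simp

lemma frob_prime_field: "x \<in> prime_field \<Longrightarrow> frob k x = x"
  by (auto simp: prime_field_def)

text \<open>For \<open>d\<close> dividing \<open>n\<close> this is the trace onto the subfield of
  order \<open>p ^ d\<close>; \<open>d = 1\<close> gives the absolute trace.\<close>

definition rel_trace :: "nat \<Rightarrow> 'a \<Rightarrow> 'a" where
  "rel_trace d x = (\<Sum>i<n div d. frob (d * i) x)"

lemma rel_trace_add: "rel_trace d (x + y) = rel_trace d x + rel_trace d y"
  by (simp add: rel_trace_def frob_add sum.distrib)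

lemma rel_trace_fixed:
  assumes "d dvd n"
  shows "frob d (rel_trace d x) = rel_trace d x"
proof -
  let ?g = "\<lambda>i. frob (d * i) x"
  have "frob d (rel_trace d x) = (\<Sum>i<n div d. ?g (Suc i))"
    by (simp add: rel_trace_def frob_sum frob_frob)
  \<comment> \<open>The shifted sum loses the term \<open>x\<close> and gains
    \<open>frob n x\<close>, which is again \<open>x\<close>.\<close>
  also have "\<dots> = (\<Sum>i<n div d. ?g i) + ?g (n div d) - ?g 0"
    using sum.lessThan_Suc_shift[of ?g "n div d"] by (simp add: algebra_simps)
  also have "\<dots> = rel_trace d x"
    using assms by (simp add: rel_trace_def frob_n)
  finally show ?thesis .
qed

text \<open>The kernel is the root set of a polynomial whose exponents are
  \<open>p ^ (d * i)\<close>, the largest being \<open>p ^ (n - d)\<close>.\<close>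

lemma card_rel_trace_kernel_le:
  assumes "d dvd n" "d \<ge> 1"
  shows "card {x. rel_trace d x = 0} \<le> p ^ (n - d)"
proof -
  obtain m where m: "n = d * m" using assms by auto
  with n have m1: "m \<ge> 1" by (cases m) auto
  let ?q = "\<Sum>i<m. Polynomial.monom (1 :: 'a) (p ^ (d * i))"
  have inj: "p ^ (d * i) = p ^ (d * j) \<longleftrightarrow> i = j" for i j
    using p_gt_1 assms by simp
  \<comment> \<open>The exponents are distinct, so the linear coefficient is 1 and the polynomial is
    nonzero.\<close>
  have "coeff ?q (p ^ (d * 0)) = (\<Sum>i<m. if i = 0 then 1 else 0)"
    unfolding coeff_sum coeff_monom by (rule sum.cong) (auto simp: inj[of _ 0, simplified])
  also have "\<dots> = 1" using m1 by simp
  finally have "?q \<noteq> 0" by force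
  then have "card {x. poly ?q x = 0} \<le> degree ?q" by (rule card_poly_roots_bound)
  also have "degree ?q \<le> p ^ (n - d)"
  proof (rule degree_sum_le)
    fix i assume "i \<in> {..<m}"
    then have "d * i \<le> d * (m - 1)" by (intro mult_left_mono) auto
    then have "p ^ (d * i) \<le> p ^ (n - d)"
      using p_gt_1 by (intro power_increasing) (auto simp: m algebra_simps)
    then show "degree (Polynomial.monom (1 :: 'a) (p ^ (d * i))) \<le> p ^ (n - d)"
      by (simp add: degree_monom_eq)
  qed simp
  finally have deg: "card {x. poly ?q x = 0} \<le> p ^ (n - d)" .
  have "n div d = m" using m assms by simp
  then have "rel_trace d x = poly ?q x" for x
    by (simp add: rel_trace_def frob_def poly_sum poly_monom)
  then show ?thesis using deg by simp
qed

text \<open>The relative trace takes values in the fixed field, and its kernel is small, so its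
  range, and with it the fixed field, must be large.\<close>

lemma card_frob_fixed_ge:
  assumes "d dvd n" "d \<ge> 1"
  shows "p ^ d \<le> card {x. frob d x = x}"
proof -
  have "d \<le> n" using assms n by (simp add: dvd_imp_le)
  then have "p ^ (n - d) * p ^ d = card (UNIV :: 'a set)"
    by (simp add: card_UNIV flip: power_add)
  also have "\<dots> = card {x. rel_trace d x = 0} * card (range (rel_trace d))"
    by (simp add: card_kernel_times_card_range rel_trace_add)
  also have "\<dots> \<le> p ^ (n - d) * card {x. frob d x = x}"
    using card_rel_trace_kernel_le[OF assms] rel_trace_fixed[OF assms(1)]
    by (intro mult_mono card_mono) auto
  finally show ?thesis using p_gt_1 by simp
qed

section \<open>The absolute trace\<close>

lemma trace_eq: "trace p n x = rel_trace 1 x"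
  by (simp add: trace_def rel_trace_def frob_def)

lemma trace_add: "trace p n (x + y) = trace p n x + trace p n (y :: 'a)"
  by (simp add: trace_eq rel_trace_add)

lemma trace_diff: "trace p n (x - y) = trace p n x - trace p n (y :: 'a)"
  using trace_add[of "x - y" y] by simp

lemma trace_in_prime_field: "trace p n (x :: 'a) \<in> prime_field"
  using rel_trace_fixed[of 1 x] by (simp add: prime_field_eq_fixed trace_eq)

lemma trace_frob: "trace p n (frob k x) = trace p n x"
proof -
  have "trace p n (frob k x) = frob k (trace p n x)"
    by (simp add: trace_eq rel_trace_def frob_sum frob_frob add.commute)
  then show ?thesis by (simp add: frob_prime_field trace_in_prime_field)
qed

lemma trace_prime_field: "x \<in> prime_field \<Longrightarrow> trace p n x = of_nat n * (x :: 'a)"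
  by (simp add: trace_eq rel_trace_def frob_prime_field)

lemma card_trace_kernel_le: "card {x :: 'a. trace p n x = 0} \<le> p ^ (n - 1)"
  using card_rel_trace_kernel_le[of 1] by (simp add: trace_eq)

lemma trace_nontrivial: "\<exists>x :: 'a. trace p n x \<noteq> 0"
proof (rule ccontr)
  assume "\<not> ?thesis"
  then have "{x :: 'a. trace p n x = 0} = UNIV" by auto
  then have "p ^ n \<le> p ^ (n - 1)" using card_trace_kernel_le card_UNIV by simp
  then show False using p_gt_1 n by simp
qed

text \<open>Additive Hilbert 90 by counting: \<open>frob 1 x - x\<close> has kernel of size
  \<open>p\<close> and lands in the trace kernel, which is no larger than its range. So the two
  coincide, and 1 has trace \<open>n\<close>, which is 0 here.\<close>

lemma artin_schreier_solution:
  assumes "p dvd n"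
  obtains w where "frob 1 w = w + 1"
proof -
  let ?h = "\<lambda>x. frob 1 x - x"
  have "card {x. ?h x = 0} * card (range ?h) = card (UNIV :: 'a set)"
    by (rule card_kernel_times_card_range) (simp add: frob_add)
  then have "p * card (range ?h) = p * p ^ (n - 1)"
    using card_prime_field n by (simp add: card_UNIV prime_field_eq_fixed flip: power_Suc)
  then have card: "card (range ?h) = p ^ (n - 1)" using p_gt_1 by simp
  have "range ?h = {x. trace p n x = 0}"
  proof (rule card_seteq)
    show "card {x :: 'a. trace p n x = 0} \<le> card (range ?h)"
      unfolding card by (rule card_trace_kernel_le)
  qed (auto simp: trace_diff trace_frob)
  moreover have "trace p n (1 :: 'a) = 0"
    using assms trace_prime_field[of 1] by (simp add: prime_field_eq_fixed of_nat_eq_0)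
  ultimately have "1 \<in> range ?h" by blast
  then obtain w where "1 = frob 1 w - w" by blast
  then have "frob 1 w = w + 1" by (simp add: algebra_simps)
  then show thesis by (rule that)
qed

section \<open>Walsh coefficients of quadratic functions\<close>

lemma fp_val_of_nat: "fp_val p (of_nat k :: 'a) = k mod p"
  unfolding fp_val_def by (rule the_equality) (use p_gt_1 in \<open>auto simp: of_nat_eq\<close>)

lemma eps_of_nat: "eps p (of_nat k :: 'a) = cis (2 * pi * real k / real p)"
proof -
  have "real k = real p * real (k div p) + real (k mod p)"
    by (metis mult_div_mod_eq of_nat_add of_nat_mult)
  then have "2 * pi * real k / real p = 2 * pi * real (k div p) + 2 * pi * real (k mod p) / real p"
    using p_gt_1 by (simp add: field_simps)
  then have "cis (2 * pi * real k / real p)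
      = cis (2 * pi * real (k div p)) * cis (2 * pi * real (k mod p) / real p)"
    by (simp only: cis_mult)
  then show ?thesis by (simp add: eps_def fp_val_of_nat cis_multiple_2pi)
qed

text \<open>Both arguments must lie in the prime field, since \<open>fp_val\<close> is a definite
  description that is unspecified elsewhere.\<close>

lemma eps_add:
  assumes "y \<in> prime_field" "z \<in> prime_field"
  shows "eps p (y + z :: 'a) = eps p y * eps p z"
proof -
  obtain j k where "y = of_nat j" "z = of_nat k" using assms by (auto simp: prime_field_def)
  then show ?thesis
    using eps_of_nat[of "j + k"] by (simp add: eps_of_nat cis_mult ring_distribs add_divide_distrib)
qed

lemma eps_ne_1:
  assumes "y \<in> prime_field" "y \<noteq> (0 :: 'a)"
  shows "eps p y \<noteq> 1"
proof
  assume 1: "eps p y = 1"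
  obtain k where k: "y = of_nat k" using assms by (auto simp: prime_field_def)
  let ?m = "k mod p"
  have m: "0 < ?m" "?m < p" using assms k p_gt_1 by (auto simp: of_nat_eq_0 dvd_eq_mod_eq_0)
  have "cos (2 * pi * real ?m / real p) = 1"
    using 1 by (auto simp: k eps_def fp_val_of_nat complex_eq_iff)
  then obtain i :: int where "2 * pi * real ?m / real p = of_int i * 2 * pi"
    by (auto simp: cos_one_2pi_int)
  then have "2 * pi * (real ?m / real p) = 2 * pi * of_int i" by simp
  then have "real ?m / real p = of_int i" using pi_neq_zero by (simp only: mult_cancel_left) simp
  moreover have "0 < real ?m / real p" "real ?m / real p < 1" using m by auto
  ultimately show False by simp
qed

text \<open>The canonical additive character of the field.\<close>

definition chi :: "'a \<Rightarrow> complex" where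
  "chi x = eps p (trace p n x)"

lemma chi_add: "chi (x + y) = chi x * chi y"
  by (simp add: chi_def trace_add eps_add trace_in_prime_field)

lemma cmod_chi [simp]: "cmod (chi x) = 1"
  by (simp add: chi_def eps_def)

lemma chi_nonzero [simp]: "chi x \<noteq> 0"
  using cmod_chi[of x] by (metis norm_zero zero_neq_one)

lemma chi_0 [simp]: "chi 0 = 1"
  using chi_add[of 0 0] by simp

lemma chi_frob: "chi (frob k x) = chi x"
  by (simp add: chi_def trace_frob)

lemma chi_mult_cnj: "chi x * cnj (chi x) = 1"
  using complex_norm_square[of "chi x"] by simp

text \<open>Orthogonality of characters. The bijection \<open>g\<close> is carried along because the
  polarised form pairs \<open>g x\<close> with \<open>M y\<close>.\<close>

lemma sum_chi_mult:
  fixes g :: "'a \<Rightarrow> 'a"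
  assumes "bij g"
  shows "(\<Sum>x\<in>UNIV. chi (g x * a)) = (if a = 0 then of_nat (p ^ n) else 0)"
proof (cases "a = 0")
  case True
  then show ?thesis by (simp add: card_UNIV)
next
  case False
  have "bij (\<lambda>x. g x * a)"
    by (rule bij_betw_trans[OF assms, unfolded comp_def],
        rule bij_betw_byWitness[where f' = "\<lambda>x. x / a"]) (use False in auto)
  then have "(\<Sum>x\<in>UNIV. chi (g x * a)) = sum chi UNIV"
    by (rule sum.reindex_bij_betw)
  also have "\<dots> = 0"
  proof -
    obtain x :: 'a where "trace p n x \<noteq> 0" using trace_nontrivial by blast
    then have "chi x \<noteq> 1" by (simp add: chi_def eps_ne_1 trace_in_prime_field)
    then show ?thesis
      by (intro sum_character_on_subgroup[where y = x]) (auto simp: chi_add)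
  qed
  finally show ?thesis using False by simp
qed

section \<open>Squared Walsh coefficients and the kernel of the bilinear form\<close>

lemma walsh_trace: "walsh p n (\<lambda>x. trace p n (Q x)) b = (\<Sum>x\<in>UNIV. chi (Q x - b * x))"
  by (simp add: walsh_def chi_def trace_diff)

text \<open>In the double sum for the squared modulus put \<open>x = z + y\<close>; summing over
  \<open>z\<close> leaves only those \<open>y\<close> with \<open>M y = 0\<close>. Polarisation is
  assumed only under \<open>chi\<close>, so that terms may be moved by Frobenius inside the
  trace.\<close>

lemma norm_square_walsh:
  fixes Q g M :: "'a \<Rightarrow> 'a"
  assumes Q: "\<And>x y. chi (Q (x + y)) = chi (Q x) * chi (Q y) * chi (g x * M y)"
    and M: "\<And>x y. M (x + y) = M x + M y" and g: "bij g"
  shows "(cmod (walsh p n (\<lambda>x. trace p n (Q x)) b))\<^sup>2 \<in> {0, real (p ^ n * card {y. M y = 0})}"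
proof -
  define h where "h x = chi (Q x - b * x)" for x
  define K where "K = {y. M y = 0}"
  have Mdiff: "M (x - y) = M x - M y" for x y using M[of "x - y" y] by simp
  have h_eq: "h x = chi (Q x) * chi (- (b * x))" for x
    using chi_add[of "Q x" "- (b * x)"] by (simp add: h_def)
  have h_add: "h (x + y) = h x * h y * chi (g x * M y)" for x y
    using chi_add[of "- (b * x)" "- (b * y)"] by (simp add: h_eq Q algebra_simps)
  have h_cnj: "h x * cnj (h x) = 1" for x by (simp add: h_def chi_mult_cnj)
  let ?W = "sum h UNIV"
  have "of_real ((cmod ?W)\<^sup>2) = (\<Sum>z\<in>UNIV. \<Sum>x\<in>UNIV. h x * cnj (h z))"
    unfolding complex_norm_square by (simp add: sum_product sum.swap[of "\<lambda>x z. h x * cnj (h z)"])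
  also have "\<dots> = (\<Sum>z\<in>UNIV. \<Sum>y\<in>UNIV. h (z + y) * cnj (h z))"
  proof (rule sum.cong[OF refl])
    fix z :: 'a
    show "(\<Sum>x\<in>UNIV. h x * cnj (h z)) = (\<Sum>y\<in>UNIV. h (z + y) * cnj (h z))"
      by (rule sum.reindex_bij_witness[of _ "\<lambda>y. z + y" "\<lambda>x. x - z"]) auto
  qed
  also have "\<dots> = (\<Sum>z\<in>UNIV. \<Sum>y\<in>UNIV. h y * chi (g z * M y))"
  proof (intro sum.cong refl)
    fix z y :: 'a
    have "h (z + y) * cnj (h z) = (h z * cnj (h z)) * (h y * chi (g z * M y))"
      by (simp only: h_add mult_ac)
    then show "h (z + y) * cnj (h z) = h y * chi (g z * M y)" by (simp add: h_cnj)
  qed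
  also have "\<dots> = (\<Sum>y\<in>UNIV. h y * (\<Sum>z\<in>UNIV. chi (g z * M y)))"
    by (subst sum.swap) (simp add: sum_distrib_left)
  also have "\<dots> = (\<Sum>y\<in>UNIV. if y \<in> K then h y * of_nat (p ^ n) else 0)"
    by (intro sum.cong refl) (simp add: sum_chi_mult[OF g] K_def)
  also have "\<dots> = of_nat (p ^ n) * sum h K"
    by (simp add: sum.If_cases sum_distrib_right mult.commute[of "of_nat p ^ n"])
  finally have W: "of_real ((cmod ?W)\<^sup>2) = of_nat (p ^ n) * sum h K" .
  \<comment> \<open>On \<open>K\<close> the pairing factor in \<open>h_add\<close> is 1, so
    \<open>h\<close> restricts to a character of \<open>K\<close>.\<close>
  have "sum h K = 0 \<or> sum h K = of_nat (card K)"
  proof (cases "\<exists>y\<in>K. h y \<noteq> 1")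
    case True
    then obtain y where "y \<in> K" "h y \<noteq> 1" by blast
    then have "sum h K = 0"
      by (intro sum_character_on_subgroup[where y = y]) (auto simp: K_def M Mdiff h_add)
    then show ?thesis ..
  qed simp
  then have "complex_of_real ((cmod ?W)\<^sup>2) = of_real 0
      \<or> complex_of_real ((cmod ?W)\<^sup>2) = of_real (real (p ^ n * card K))"
    unfolding W by auto
  then have "(cmod ?W)\<^sup>2 \<in> {0, real (p ^ n * card K)}"
    unfolding of_real_eq_iff by auto
  then show ?thesis unfolding K_def walsh_trace h_def[symmetric] .
qed

text \<open>Fourier inversion at 0: the coefficients add up to \<open>p ^ n\<close> times the
  unimodular number \<open>chi (Q 0)\<close>.\<close>

lemma walsh_nonzero: "\<exists>b. walsh p n (\<lambda>x :: 'a. trace p n (Q x)) b \<noteq> 0"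
proof (rule ccontr)
  let ?W = "walsh p n (\<lambda>x :: 'a. trace p n (Q x))"
  assume "\<not> ?thesis"
  then have "0 = (\<Sum>b\<in>UNIV. ?W b)" by simp
  also have "\<dots> = (\<Sum>x\<in>UNIV. \<Sum>b\<in>UNIV. chi (Q x) * chi (- b * x))"
    unfolding walsh_trace by (subst sum.swap) (simp flip: chi_add)
  also have "\<dots> = (\<Sum>x\<in>UNIV. if x = 0 then chi (Q x) * of_nat (p ^ n) else 0)"
    by (intro sum.cong refl)
       (simp only: sum_distrib_left[symmetric] sum_chi_mult[OF bij_uminus] mult_zero_right
          split: if_split, simp)
  also have "\<dots> = chi (Q 0) * of_nat (p ^ n)" by simp
  finally show False using p_gt_1 by simp
qed

lemma near_bent_iff_card_kernel:
  fixes Q g M :: "'a \<Rightarrow> 'a"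
  assumes "\<And>x y. chi (Q (x + y)) = chi (Q x) * chi (Q y) * chi (g x * M y)"
    and "\<And>x y. M (x + y) = M x + M y" and "bij g"
  shows "near_bent p n (\<lambda>x. trace p n (Q x)) \<longleftrightarrow> card {y. M y = 0} = p"
proof
  assume "card {y. M y = 0} = p"
  then show "near_bent p n (\<lambda>x. trace p n (Q x))"
    unfolding near_bent_def using norm_square_walsh[of Q g M, OF assms] by (simp add: mult.commute)
next
  assume nb: "near_bent p n (\<lambda>x. trace p n (Q x))"
  obtain b where b: "walsh p n (\<lambda>x. trace p n (Q x)) b \<noteq> 0" using walsh_nonzero by blast
  have "real (p ^ (n + 1)) = (cmod (walsh p n (\<lambda>x. trace p n (Q x)) b))\<^sup>2"
    using nb b unfolding near_bent_def by auto
  also have "\<dots> = real (p ^ n * card {y. M y = 0})"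
    using norm_square_walsh[of Q g M b, OF assms] b by auto
  finally have "p ^ n * p = p ^ n * card {y. M y = 0}"
    by (simp only: of_nat_eq_iff power_add power_one_right)
  then show "card {y. M y = 0} = p" using p_gt_1 by auto
qed

text \<open>The sign \<open>s\<close> treats both binomials at once; all that matters is that
  Frobenius fixes it and that its square is 1.\<close>

lemma near_bent_binomial_iff:
  assumes "t < r" and c: "c \<in> prime_field" "c \<noteq> 0" and s: "s = 1 \<or> s = -1"
  shows "near_bent p n (\<lambda>x :: 'a. trace p n (c * x ^ (p ^ r + 1) + s * (c * x ^ (p ^ t + 1))))
    \<longleftrightarrow> card {y. frob (r + t) (frob (r - t) y + s * y) + s * (frob (r - t) y + s * y) = 0} = p"
proof -
  define M where
    "M y = frob (r + t) (frob (r - t) y + s * y) + s * (frob (r - t) y + s * y)" for y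
  define g where "g x = c * frob r x" for x
  have s': "frob k s = s" "s * s = 1" for k using s by (auto simp: frob_uminus)
  \<comment> \<open>Expanding the factored operator uses \<open>s * s = 1\<close> and
    \<open>(r + t) + (r - t) = r + r\<close>.\<close>
  have M_eq: "M y = y + frob (r + r) y + s * frob (r + t) y + s * frob (r - t) y" for y
    using \<open>t < r\<close> s'(2)
    by (simp add: M_def frob_add frob_mult s' frob_frob algebra_simps flip: mult.assoc)
  have chi_swap: "chi (c * a) = chi (c * frob k a)" for a k
    using chi_frob[of k "c * a"] by (simp add: frob_mult frob_prime_field c)
  have "chi (c * (x + y) ^ (p ^ r + 1) + s * (c * (x + y) ^ (p ^ t + 1)))
      = chi (c * x ^ (p ^ r + 1) + s * (c * x ^ (p ^ t + 1)))
        * chi (c * y ^ (p ^ r + 1) + s * (c * y ^ (p ^ t + 1))) * chi (g x * M y)" for x y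
  proof -
    have pow: "z ^ (p ^ k + 1) = frob k z * z" for z k by (simp add: frob_def)
    \<comment> \<open>The cross terms. Applying \<open>frob r\<close> or \<open>frob (r - t)\<close>
      under \<open>chi\<close> turns every occurrence of \<open>x\<close> into
      \<open>frob r x\<close>, which can then be factored out.\<close>
    let ?B = "c * (frob r x * y) + c * (x * frob r y) + c * (s * (frob t x * y))
      + c * (s * (x * frob t y))"
    have "c * (x + y) ^ (p ^ r + 1) + s * (c * (x + y) ^ (p ^ t + 1))
      = c * x ^ (p ^ r + 1) + s * (c * x ^ (p ^ t + 1))
        + (c * y ^ (p ^ r + 1) + s * (c * y ^ (p ^ t + 1))) + ?B"
      unfolding pow by (simp add: frob_add algebra_simps)
    moreover have "chi ?B = chi (g x * M y)"
    proof -
      have "chi (c * (x * frob r y)) = chi (c * (frob r x * frob (r + r) y))"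
        using chi_swap[of "x * frob r y" r] by (simp add: frob_mult frob_frob)
      moreover have "chi (c * (s * (frob t x * y))) = chi (c * (s * (frob r x * frob (r - t) y)))"
        using chi_swap[of "s * (frob t x * y)" "r - t"] \<open>t < r\<close>
        by (simp add: frob_mult frob_frob s')
      moreover have "chi (c * (s * (x * frob t y))) = chi (c * (s * (frob r x * frob (r + t) y)))"
        using chi_swap[of "s * (x * frob t y)" r] by (simp add: frob_mult frob_frob s')
      ultimately have "chi ?B = chi (c * (frob r x * y) + c * (frob r x * frob (r + r) y)
          + c * (s * (frob r x * frob (r - t) y)) + c * (s * (frob r x * frob (r + t) y)))"
        by (simp add: chi_add)
      also have "\<dots> = chi (g x * M y)"
        by (rule arg_cong[of _ _ chi]) (simp add: g_def M_eq algebra_simps)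
      finally show ?thesis .
    qed
    ultimately show ?thesis by (simp only: chi_add)
  qed
  moreover have "M (x + y) = M x + M y" for x y
    by (simp add: M_eq frob_add algebra_simps)
  moreover have "bij g"
  proof -
    have "inj g"
      using inj_frob[of r] c by (auto simp: inj_def g_def)
    then show ?thesis by (simp add: finite_UNIV_inj_surj bij_def)
  qed
  ultimately show ?thesis
    unfolding M_def[symmetric] by (rule near_bent_iff_card_kernel)
qed

section \<open>Kernels of products of shifted Frobenius powers\<close>

text \<open>The fixed field of \<open>frob (gcd n k)\<close> has at least \<open>p ^ gcd n k\<close>
  elements, all of them fixed by \<open>frob k\<close>.\<close>

lemma gcd_eq_1_if_card_le:
  assumes "card {x. frob k x = x} \<le> p"
  shows "gcd n k = 1"
proof -
  have g: "gcd n k \<ge> 1" using n by (simp add: Suc_le_eq)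
  have "{x. frob (gcd n k) x = x} \<subseteq> {x. frob k x = x}"
    using frob_fixed_mult[of "gcd n k" _ "k div gcd n k"] by auto
  then have "p ^ gcd n k \<le> card {x. frob k x = x}"
    using card_frob_fixed_ge[of "gcd n k"] g card_mono[of "{x. frob k x = x}"]
    by (meson dual_order.trans finite gcd_dvd1)
  with assms have "p ^ gcd n k \<le> p ^ 1" by simp
  with g show ?thesis using p_gt_1 by (simp only: power_increasing_iff)
qed

lemma card_kernel_minus:
  "card {y. frob a (frob b y - y) - (frob b y - y) = 0} = p
    \<longleftrightarrow> gcd n a = 1 \<and> gcd n b = 1 \<and> gcd n p = 1"
proof -
  let ?K = "{y. frob a (frob b y - y) - (frob b y - y) = 0}"
  have coprime: "gcd n p = 1 \<longleftrightarrow> \<not> p dvd n"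
  proof
    assume "gcd n p = 1"
    then show "\<not> p dvd n" using p_gt_1 by (auto simp: gcd_nat.absorb2)
  next
    assume "\<not> p dvd n"
    then show "gcd n p = 1"
      using prime_imp_coprime[OF p, of n] by (simp add: coprime_iff_gcd_eq_1 gcd.commute)
  qed
  have sub: "prime_field \<subseteq> ?K"
    by (auto simp: frob_prime_field)
  show ?thesis
  proof
    assume K: "card ?K = p"
    have "frob a (frob b y) = frob b (frob a y)" for y by (simp add: frob_frob add.commute)
    then have "{y. frob a y = y} \<subseteq> ?K" by (auto simp: frob_diff)
    then have "card {y. frob a y = y} \<le> p" using card_mono[of ?K] K by simp
    moreover have "{y. frob b y = y} \<subseteq> ?K" by auto
    then have "card {y. frob b y = y} \<le> p" using card_mono[of ?K] K by simp
    moreover have "\<not> p dvd n"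
    proof
      assume "p dvd n"
      \<comment> \<open>Iteration shifts \<open>w\<close> by constants, so
        \<open>frob b w - w\<close> is in the prime field and \<open>frob a\<close> fixes it. Thus
        \<open>w\<close> is a kernel element outside the prime field.\<close>
      then obtain w where w: "frob 1 w = w + 1" by (rule artin_schreier_solution)
      have "frob k w = w + of_nat k" for k
      proof (induction k)
        case (Suc k)
        have "frob (Suc k) w = frob 1 (frob k w)" by (simp add: frob_frob)
        also have "\<dots> = w + of_nat (Suc k)" unfolding Suc frob_add w by simp
        finally show ?case .
      qed simp
      then have "w \<in> ?K" by simp
      moreover have "prime_field = ?K"
        by (rule card_seteq) (use sub K in \<open>simp_all add: card_prime_field\<close>)
      ultimately have "frob 1 w = w" by (auto simp: prime_field_eq_fixed simp del: One_nat_def)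
      then show False using w by simp
    qed
    ultimately show "gcd n a = 1 \<and> gcd n b = 1 \<and> gcd n p = 1"
      using coprime by (simp only: gcd_eq_1_if_card_le simp_thms)
  next
    assume *: "gcd n a = 1 \<and> gcd n b = 1 \<and> gcd n p = 1"
    have "?K \<subseteq> prime_field"
    proof safe
      fix y assume "frob a (frob b y - y) - (frob b y - y) = 0"
      then have z: "frob b y - y \<in> prime_field"
        using frob_fixed_gcd[of a "frob b y - y"] * by (simp add: prime_field_eq_fixed)
      \<comment> \<open>On the prime field the trace is multiplication by \<open>n\<close>, whereas
        the trace of \<open>frob b y - y\<close> is 0 by Frobenius invariance.\<close>
      have "of_nat n * (frob b y - y) = 0"
        unfolding trace_prime_field[OF z, symmetric] by (simp add: trace_diff trace_frob)
      then have "frob b y = y" using * coprime by (simp add: of_nat_eq_0)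
      then show "y \<in> prime_field"
        using frob_fixed_gcd[of b y] * by (simp add: prime_field_eq_fixed)
    qed
    with sub have "?K = prime_field" by blast
    then show "card ?K = p" by (simp add: card_prime_field)
  qed
qed

section \<open>The plus sign: change of sign by scaling, and parity\<close>

lemma antifixed_element:
  assumes "even n"
  obtains u where "u \<noteq> 0" "frob 1 u = - u"
proof -
  have "p < p ^ 2" using p_gt_1 by (simp add: power2_eq_square)
  then have "card (prime_field :: 'a set) < card {x. frob 2 x = x}"
    using card_frob_fixed_ge[of 2] assms card_prime_field by simp
  then have "\<not> {x. frob 2 x = x} \<subseteq> prime_field"
    by (metis card_mono finite leD)
  then obtain v where v: "frob 2 v = v" "frob 1 v \<noteq> v" by (auto simp: prime_field_eq_fixed)
  \<comment> \<open>Frobenius swaps \<open>v\<close> and \<open>frob 1 v\<close>, so their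
    difference changes sign.\<close>
  have "frob 1 (frob 1 v - v) = - (frob 1 v - v)"
    using v by (simp add: frob_diff frob_frob numeral_2_eq_2)
  then show thesis using v by (intro that[of "frob 1 v - v"]) auto
qed

lemma frob_eigenvector:
  assumes "frob 1 y = l * y" and "l \<in> prime_field"
  shows "frob k y = l ^ k * y"
proof (induction k)
  case (Suc k)
  have "frob (Suc k) y = frob 1 (frob k y)" by (simp add: frob_frob)
  also have "\<dots> = frob 1 (l ^ k) * (l * y)" unfolding Suc frob_mult assms(1) ..
  also have "frob 1 (l ^ k) = frob 1 l ^ k"
    by (simp add: frob_def mult.commute flip: power_mult)
  also have "frob 1 l = l" using assms(2) by (rule frob_prime_field)
  finally show ?case by simp
qed simp

text \<open>Multiplication by an element \<open>u\<close> with \<open>u\<^sup>p = -u\<close> turns \<open>\<sigma>\<^sup>k - 1\<close> into \<open>-(\<sigma>\<^sup>k + 1)\<close> for odd \<open>k\<close>.\<close>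

lemma card_kernel_plus_odd:
  assumes "even n" "odd a" "odd b"
  shows "card {y. frob a (frob b y + y) + (frob b y + y) = 0}
    = card {y. frob a (frob b y - y) - (frob b y - y) = 0}"
proof -
  obtain u where u: "u \<noteq> 0" "frob 1 u = - u" using antifixed_element assms by blast
  have "frob k u = (-1) ^ k * u" for k
    by (rule frob_eigenvector) (use u in \<open>auto simp: prime_field_eq_fixed frob_uminus\<close>)
  then have k: "frob a u = - u" "frob b u = - u" using assms by auto
  have "frob a (frob b (u * y) + u * y) + (frob b (u * y) + u * y)
      = u * (frob a (frob b y - y) - (frob b y - y))" for y
    by (simp add: frob_add frob_diff frob_mult frob_uminus k algebra_simps)
  then have eq: "frob a (frob b (u * y) + u * y) + (frob b (u * y) + u * y) = 0
      \<longleftrightarrow> frob a (frob b y - y) - (frob b y - y) = 0" for y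
    using u by simp
  have "bij_betw ((*) u) {y. frob a (frob b y - y) - (frob b y - y) = 0}
      {y. frob a (frob b y + y) + (frob b y + y) = 0}"
  proof (rule bij_betw_byWitness[where f' = "\<lambda>y. y / u"])
    have "frob a (frob b (y / u) - y / u) - (frob b (y / u) - y / u) = 0"
      if "frob a (frob b y + y) + (frob b y + y) = 0" for y
      using eq[of "y / u"] that u by simp
    then show "(\<lambda>y. y / u) ` {y. frob a (frob b y + y) + (frob b y + y) = 0}
        \<subseteq> {y. frob a (frob b y - y) - (frob b y - y) = 0}" by blast
  qed (use u eq in auto)
  then show ?thesis by (simp add: bij_betw_same_card)
qed

text \<open>A kernel of order \<open>p\<close> is a line \<open>F\<^sub>p y\<close> on which \<open>\<sigma>\<close> acts by a scalar \<open>l\<close>. The operator is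
  self-reciprocal in \<open>\<sigma>\<close>, so \<open>y\<^bsup>-1\<^esup>\<close>, with eigenvalue \<open>l\<^bsup>-1\<^esup>\<close>, lies on the same line; this
  forces \<open>l = -1\<close>.\<close>

lemma card_kernel_plus_parity:
  assumes "odd p" and "even (a + b)"
    and K: "card {y. frob a (frob b y + y) + (frob b y + y) = 0} = p"
  shows "even n \<and> odd a \<and> odd b"
proof -
  define K where "K = {y. frob a (frob b y + y) + (frob b y + y) = 0}"
  have two: "(2 :: 'a) \<noteq> 0"
    using of_nat_eq_0[of 2] \<open>odd p\<close> p by (auto dest: primes_dvd_imp_eq[OF _ two_is_prime_nat])
  then have four: "(4 :: 'a) \<noteq> 0"
    using mult_eq_0_iff[of "2 :: 'a" 2] by simp
  have "\<not> K \<subseteq> {0}"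
    using card_mono[of "{0}" K] K p_gt_1 by (auto simp: K_def)
  then obtain y where y: "y \<in> K" "y \<noteq> 0" by auto
  \<comment> \<open>\<open>K\<close> is closed under scaling by the prime field and has only
    \<open>p\<close> elements, so any nonzero element spans it.\<close>
  have K_eq: "(\<lambda>m. m * y) ` prime_field = K"
  proof (rule card_seteq)
    show "(\<lambda>m. m * y) ` prime_field \<subseteq> K"
    proof safe
      fix m :: 'a assume m: "m \<in> prime_field"
      have "frob a (frob b (m * y) + m * y) + (frob b (m * y) + m * y)
          = m * (frob a (frob b y + y) + (frob b y + y))"
        by (simp add: frob_add frob_mult frob_prime_field m algebra_simps)
      then show "m * y \<in> K" using y by (simp add: K_def)
    qed
    have "inj_on (\<lambda>m. m * y) prime_field" using y by (auto intro: inj_onI)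
    then have "card ((\<lambda>m. m * y) ` prime_field) = p"
      by (simp add: card_image card_prime_field)
    then show "card K \<le> card ((\<lambda>m. m * y) ` prime_field)" using K by (simp add: K_def)
  qed (simp add: K_def)
  have "frob 1 y \<in> K"
  proof -
    have "frob a (frob b (frob 1 y) + frob 1 y) + (frob b (frob 1 y) + frob 1 y)
        = frob 1 (frob a (frob b y + y) + (frob b y + y))"
      by (simp add: frob_add frob_frob add.commute)
    then show ?thesis using y by (simp add: K_def)
  qed
  then obtain l where l: "l \<in> prime_field" "frob 1 y = l * y" using K_eq by auto
  have l0: "l \<noteq> 0" using l(2) y(2) frob_eq_0_iff[of 1 y] by auto
  have fy: "frob k y = l ^ k * y" for k by (rule frob_eigenvector) (use l in auto)
  have "(l ^ a + 1) * (l ^ b + 1) * y = frob a (frob b y + y) + (frob b y + y)"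
    by (simp add: frob_add frob_frob) (simp add: fy power_add algebra_simps)
  also have "\<dots> = 0" using y by (simp add: K_def)
  finally have prod0: "(l ^ a + 1) * (l ^ b + 1) = 0" using y by simp
  let ?z = "inverse y"
  have fz: "frob k ?z = inverse l ^ k * ?z" for k by (simp add: frob_inverse fy power_inverse)
  have "frob a (frob b ?z + ?z) + (frob b ?z + ?z) = (inverse l ^ a + 1) * (inverse l ^ b + 1) * ?z"
    by (simp add: frob_add frob_frob) (simp add: fz power_add algebra_simps)
  \<comment> \<open>Pulling out the powers of \<open>inverse l\<close> reproduces the vanishing
    product for \<open>l\<close>.\<close>
  also have "(inverse l ^ a + 1) * (inverse l ^ b + 1)
      = inverse l ^ a * inverse l ^ b * ((l ^ a + 1) * (l ^ b + 1))"
    using l0 by (simp add: field_simps)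
  finally have "?z \<in> K" by (simp add: prod0 K_def)
  then obtain m where m: "m \<in> prime_field" "?z = m * y" using K_eq by auto
  \<comment> \<open>As a scalar multiple of \<open>y\<close>, the inverse also has eigenvalue
    \<open>l\<close>; comparison with \<open>inverse l\<close> gives
    \<open>l * l = 1\<close>.\<close>
  have "frob 1 ?z = l * ?z"
    unfolding m(2) frob_mult l(2) frob_prime_field[OF m(1)] by (rule mult.left_commute)
  then have "inverse l = l" using fz[of 1] y by simp
  then have "l * l = 1" using l0 by (metis left_inverse)
  then have "l = 1 \<or> l = -1" by (simp add: square_eq_1_iff)
  moreover have "l \<noteq> 1" using prod0 two by auto
  ultimately have l: "l = -1" by simp
  \<comment> \<open>If \<open>b\<close> were even, so would be \<open>a\<close>, and the product
    would be 4, which is nonzero in odd characteristic.\<close>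
  have "odd b"
  proof
    assume "even b"
    then have "even a" using assms by simp
    then show False using \<open>even b\<close> prod0 four by (simp add: l)
  qed
  moreover have "l ^ n = 1" using fy[of n] y by (simp add: frob_n)
  then have "even n" using two l by (cases "even n") auto
  ultimately show ?thesis using assms by simp
qed

lemma card_kernel_plus:
  assumes "odd p" and "even (a + b)"
  shows "card {y. frob a (frob b y + y) + (frob b y + y) = 0} = p
    \<longleftrightarrow> gcd n (2 * a) = 2 \<and> gcd n (2 * b) = 2 \<and> odd b \<and> gcd n p = 1"
\<comment> \<open>Outside this case both sides fail: the right side gives \<open>n\<close> even and
  \<open>b\<close> odd, hence \<open>a\<close> odd as \<open>a + b\<close> is even; the left side
  gives the same by the parity lemma.\<close>
proof (cases "even n \<and> odd a \<and> odd b")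
  case True
  have gcd_iff: "gcd n (2 * k) = 2 \<longleftrightarrow> gcd n k = 1" if "odd k" for k
  proof -
    \<comment> \<open>Both gcds reduce to \<open>gcd m k\<close>: one by taking out the factor 2,
      the other because \<open>k\<close> is odd.\<close>
    obtain m where m: "n = 2 * m" using True by auto
    have "gcd n (2 * k) = 2 * gcd m k" by (simp add: m gcd_mult_distrib_nat)
    moreover have "gcd n k = gcd m k"
      unfolding m using that by (intro gcd_mult_left_left_cancel) simp
    ultimately show ?thesis by simp
  qed
  then show ?thesis using True card_kernel_plus_odd[of a b] card_kernel_minus[of a b] by simp
next
  case False
  moreover have "even n" if "gcd n (2 * b) = 2"
    using that by (metis gcd_dvd1)
  ultimately show ?thesis using card_kernel_plus_parity[OF assms] assms by auto
qed

end

theorem theorem4: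
  fixes p n r t :: nat and c :: "'a::{field,finite}"
  assumes "prime p" and "odd p" and "n \<ge> 1"
    and "card (UNIV :: 'a set) = p ^ n"
    and "t < r"
    and "c \<in> prime_field" and "c \<noteq> 0"
  shows "(near_bent p n (\<lambda>x. trace p n (c * x ^ (p ^ r + 1) - c * x ^ (p ^ t + 1)))
            \<longleftrightarrow> gcd n (r + t) = 1 \<and> gcd n (r - t) = 1 \<and> gcd n p = 1)
       \<and> (near_bent p n (\<lambda>x. trace p n (c * x ^ (p ^ r + 1) + c * x ^ (p ^ t + 1)))
            \<longleftrightarrow> gcd n (2 * (r + t)) = 2 \<and> gcd n (2 * (r - t)) = 2 \<and> odd (r - t)
                \<and> gcd n p = 1)"
proof -
  interpret finite_field_ext p n "TYPE('a)"
    by unfold_locales (use assms in auto)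
  \<comment> \<open>The sum is \<open>2 * r\<close>, the subtraction being exact since
    \<open>t < r\<close>.\<close>
  have "even ((r + t) + (r - t))" using assms by simp
  then show ?thesis
    using near_bent_binomial_iff[OF assms(5-7), of "-1"] near_bent_binomial_iff[OF assms(5-7), of 1]
    unfolding card_kernel_minus[of "r + t" "r - t", symmetric]
      card_kernel_plus[OF assms(2) \<open>even ((r + t) + (r - t))\<close>, symmetric]
    by (simp only: mult_1 mult_minus1 diff_conv_add_uminus[symmetric] simp_thms)
qed

end
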